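(* There exist $t_0>0$ and a solution $X(t)=(x(t),y(t),z(t))$, $t\in\mathbb{R}$, of the ODE system $$\dot x=\sin z+\cos y,\qquad \dot y=\sin x+\cos z,\qquad \dot z=\sin y+\cos x$$ in $\mathbb{R}^3$ such that for each $t\in\mathbb{R}$ $$X(t+t_0)=X(t)+(2\pi,0,0).$$ Moreover, $Y(t)=(z(t),x(t),y(t))$ and $Z(t)=(y(t),z(t),x(t))$ are then also solutions of the same system and satisfy, for each $t\in\mathbb{R}$, $$Y(t+t_0)=Y(t)+(0,2\pi,0)\qquad\text{and}\qquad Z(t+t_0)=Z(t)+(0,0,2\pi).$$
   Context: The ODE system in the claim is the 1-1-1 ABC (Arnold-Beltrami-Childress) flow system, i.e. $\dot X=u(X)$ with $u(x,y,z)=(\sin z+\cos y,\ \sin x+\cos z,\ \sin y+\cos x)$. *)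

theory Defs
  imports "HOL-Analysis.Analysis"
begin

text \<open>The 1-1-1 Arnold-Beltrami-Childress vector field on \<open>\<real>\<^sup>3\<close>;
  the components \<open>$ 1\<close>, \<open>$ 2\<close>, \<open>$ 3\<close> are \<open>x\<close>, \<open>y\<close>, \<open>z\<close>.\<close>

definition abc_field :: "real ^ 3 \<Rightarrow> real ^ 3" where
  "abc_field p = vector [sin (p $ 3) + cos (p $ 2),
                         sin (p $ 1) + cos (p $ 3),
                         sin (p $ 2) + cos (p $ 1)]"

definition abc_solution :: "(real \<Rightarrow> real ^ 3) \<Rightarrow> bool" where
  "abc_solution X \<longleftrightarrow> (\<forall>t. (X has_vector_derivative abc_field (X t)) (at t))"

end

theory Submission
  imports Defs
begin

text \<open>In the coordinate \<open>w = z - \<pi>/2\<close> the system reads \<open>x' = cos w + cos y\<close>,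
  \<open>y' = sin x - sin w\<close>, \<open>w' = sin y + cos x\<close>.  It is time-reversible under both
  \<open>(x, y, z) \<mapsto> (-x, y, \<pi> - z)\<close>, which fixes the line \<open>x = 0, z = \<pi>/2\<close>, and
  \<open>(x, y, z) \<mapsto> (\<pi> - x, -y, z)\<close>, which fixes the line \<open>x = \<pi>/2, y = 0\<close>.  The square of
  the composition is the translation by \<open>(2\<pi>, 0, 0)\<close>, so an orbit running from the first line
  to the second one in time \<open>T\<close> is ballistic with \<open>t\<^sub>0 = 4T\<close>.

  Such an orbit is found by shooting from \<open>(0, a, \<pi>/2)\<close>, \<open>-\<pi>/2 \<le> a \<le> 0\<close>.  As long as
  \<open>x \<le> \<pi>/2\<close> and \<open>y \<le> 0\<close>, the variables \<open>x\<close> and \<open>y\<close> increase, so the orbit leaves this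
  quadrant, transversally, through the side \<open>x = \<pi>/2\<close>, through the top \<open>y = 0\<close>, or through the
  corner.  For \<open>a = 0\<close> it crosses the top, for \<open>a = -\<pi>/2\<close> it does not; crossing the top and
  crossing the side are open conditions on \<open>a\<close>, so connectedness yields an \<open>a\<close> whose orbit
  hits the corner.\<close>

subsection \<open>Flows of Lipschitz vector fields\<close>

text \<open>Substituting \<open>X t = exp (K * t) *\<^sub>R f t\<close> with \<open>K > L\<close> turns the Picard operator into a
  contraction of the bounded functions \<open>f\<close> on the whole half line, so no local solutions have to
  be patched together.  Functions are frozen at \<open>t = 0\<close> for negative \<open>t\<close>.\<close>

lemma lipschitz_forward_flow:
  fixes F :: "'a::banach \<Rightarrow> 'a"
  assumes F: "L-lipschitz_on UNIV F"
  obtains X :: "'a \<Rightarrow> real \<Rightarrow> 'a" where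
    "\<And>a. X a 0 = a"
    "\<And>a t. 0 \<le> t \<Longrightarrow> (X a has_vector_derivative F (X a t)) (at t within {0..})"
    "\<And>a b t. 0 \<le> t \<Longrightarrow> dist (X a t) (X b t) \<le> (L + 1) * exp ((L + 1) * t) * dist a b"
proof -
  \<comment> \<open>Not only is \<open>L / K\<close> below 1: since \<open>K - L = 1\<close>, also
    \<open>1 / (1 - L / K) = K\<close>, which becomes the factor \<open>L + 1\<close> in the final
    estimate.\<close>
  define K where "K = L + 1"
  have L: "0 \<le> L" and K: "0 < K" "L / K < 1" "0 \<le> L / K"
    using lipschitz_on_nonneg[OF F] by (auto simp: K_def)
  have Fc: "continuous_on A F" for A
    using lipschitz_on_continuous_on[OF F] continuous_on_subset by blast
  define G :: "(real \<Rightarrow>\<^sub>C 'a) \<Rightarrow> real \<Rightarrow> 'a" where "G f s = F (exp (K * s) *\<^sub>R f s)" for f s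
  define I where "I f t = integral {0..t} (G f)" for f t
  define Q where "Q a f t = exp (- (K * max 0 t)) *\<^sub>R (a + I f (max 0 t))" for a f t
  have Gc: "continuous_on A (G f)" for A f
    unfolding G_def
    by (rule continuous_on_compose2[OF Fc[of UNIV]]) (auto intro!: continuous_intros)
  have Gi: "G f integrable_on {a..b}" for f a b
    by (rule integrable_continuous_real[OF Gc])
  have Ei: "((\<lambda>s. C * exp (K * s)) has_integral C / K * (exp (K * t) - 1)) {0..t}" if "0 \<le> t" for t C
  proof -
    have "((\<lambda>s. C / K * exp (K * s)) has_vector_derivative C * exp (K * s)) (at s within {0..t})" for s
      using K by (auto intro!: derivative_eq_intros simp: has_real_derivative_iff_has_vector_derivative[symmetric])
    from fundamental_theorem_of_calculus[OF that this]
    show ?thesis by (simp add: algebra_simps)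
  qed
  \<comment> \<open>Integrating \<open>exp (K * s)\<close> gains a factor \<open>1 / K\<close>, and
    the weight cancels the remaining growth. The contraction comes from this gain.\<close>
  have Ibound: "norm (exp (- (K * t)) *\<^sub>R integral {0..t} g) \<le> C / K"
    if g: "\<And>s. 0 \<le> s \<Longrightarrow> norm (g s) \<le> C * exp (K * s)" and gi: "g integrable_on {0..t}"
      and t: "0 \<le> t" and C: "0 \<le> C" for t C and g :: "real \<Rightarrow> 'a"
  proof -
    have "norm (integral {0..t} g) \<le> integral {0..t} (\<lambda>s. C * exp (K * s))"
      using Ei[OF t] g gi by (intro integral_norm_bound_integral) auto
    also have "\<dots> = C / K * (exp (K * t) - 1)"
      using Ei[OF t] by (rule integral_unique)
    also have "\<dots> \<le> C / K * exp (K * t)"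
      using C K by (intro mult_left_mono) auto
    finally have "exp (- (K * t)) * norm (integral {0..t} g) \<le> exp (- (K * t)) * (C / K * exp (K * t))"
      by (intro mult_left_mono) auto
    also have "\<dots> = C / K" by (simp add: exp_minus field_simps)
    finally show ?thesis by simp
  qed
  have Gb: "norm (G f s) \<le> (norm (F 0) + L * norm f) * exp (K * s)" if "0 \<le> s" for f s
  proof -
    have "norm (G f s) \<le> norm (F 0) + dist (G f s) (F 0)"
      using norm_triangle_sub[of "G f s" "F 0"] by (simp add: dist_norm)
    also have "dist (G f s) (F 0) \<le> L * (exp (K * s) * norm (f s))"
      unfolding G_def using lipschitz_onD[OF F, of "exp (K * s) *\<^sub>R f s" 0] by simp
    also have "\<dots> \<le> L * (exp (K * s) * norm f)"
      using L by (intro mult_left_mono norm_bounded) auto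
    also have "norm (F 0) \<le> norm (F 0) * exp (K * s)"
      using that K by (simp add: mult_le_cancel_left1)
    finally show ?thesis by (simp add: algebra_simps)
  qed
  have Ic: "continuous_on {0..} (I f)" for f
  proof -
    have "(I f has_vector_derivative G f t) (at t within {0..b})" if "t \<in> {0..b}" for t b
      unfolding I_def by (rule integral_has_vector_derivative[OF Gc that])
    hence cont: "continuous_on {0..b} (I f)" for b
      by (intro continuous_on_vector_derivative)
    show ?thesis
      unfolding continuous_on_def
    proof
      fix t :: real assume "t \<in> {0..}"
      have "(I f \<longlongrightarrow> I f t) (at t within {0..t+1})"
        using cont[of "t+1"] \<open>t \<in> {0..}\<close>
        unfolding continuous_on_def by auto
      also have "at t within {0..t+1} = at t within {0..}"
        by (rule at_within_nhd[of _ "{..<t+1}"]) auto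
      finally show "(I f \<longlongrightarrow> I f t) (at t within {0..})" .
    qed
  qed
  have Qc: "Q a f \<in> bcontfun" for a f
  proof (rule bcontfun_normI)
    have "continuous_on UNIV (\<lambda>t::real. I f (max 0 t))"
      by (rule continuous_on_compose2[OF Ic]) (auto intro!: continuous_intros)
    thus "continuous_on UNIV (Q a f)"
      unfolding Q_def by (auto intro!: continuous_intros)
    show "norm (Q a f t) \<le> norm a + (norm (F 0) + L * norm f) / K" for t
    proof -
      let ?t = "max 0 t"
      have "norm (Q a f t) \<le> norm (exp (- (K * ?t)) *\<^sub>R a) + norm (exp (- (K * ?t)) *\<^sub>R I f ?t)"
        unfolding Q_def scaleR_add_right by (rule norm_triangle_ineq)
      also have "norm (exp (- (K * ?t)) *\<^sub>R I f ?t) \<le> (norm (F 0) + L * norm f) / K"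
        unfolding I_def using Gb L by (intro Ibound Gi) auto
      also have "norm (exp (- (K * ?t)) *\<^sub>R a) \<le> norm a"
        using K by (simp add: mult_left_le_one_le)
      finally show ?thesis by simp
    qed
  qed
  define P where "P a f = Bcontfun (Q a f)" for a f
  have P: "P a f t = Q a f t" for a f t
    unfolding P_def using Qc by (simp add: Bcontfun_inverse)
  \<comment> \<open>Both arguments vary: \<open>a = b\<close> gives the contraction, and taking
    fixed points for \<open>f\<close> and \<open>g\<close> gives the dependence on the initial
    value.\<close>
  have Pd: "dist (P a f) (P b g) \<le> dist a b + L / K * dist f g" for a b f g
  proof (rule dist_bound)
    fix t :: real
    let ?t = "max 0 t"
    have "dist (P a f t) (P b g t) = norm (exp (- (K * ?t)) *\<^sub>R (a - b)
        + exp (- (K * ?t)) *\<^sub>R integral {0..?t} (\<lambda>s. G f s - G g s))"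
      unfolding P Q_def I_def dist_norm integral_diff[OF Gi Gi]
      by (simp add: algebra_simps)
    also have "\<dots> \<le> norm (exp (- (K * ?t)) *\<^sub>R (a - b))
        + norm (exp (- (K * ?t)) *\<^sub>R integral {0..?t} (\<lambda>s. G f s - G g s))"
      by (rule norm_triangle_ineq)
    also have "norm (exp (- (K * ?t)) *\<^sub>R (a - b)) \<le> dist a b"
      using K by (simp add: mult_left_le_one_le dist_norm)
    also have "norm (exp (- (K * ?t)) *\<^sub>R integral {0..?t} (\<lambda>s. G f s - G g s)) \<le> (L * dist f g) / K"
    proof (rule Ibound)
      fix s :: real
      have "norm (G f s - G g s) \<le> L * (exp (K * s) * dist (f s) (g s))"
        unfolding G_def
        using lipschitz_onD[OF F, of "exp (K * s) *\<^sub>R f s" "exp (K * s) *\<^sub>R g s"]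
        by (simp add: dist_norm flip: scaleR_diff_right)
      also have "\<dots> \<le> L * (exp (K * s) * dist f g)"
        using L by (intro mult_left_mono dist_bounded) auto
      finally show "norm (G f s - G g s) \<le> L * dist f g * exp (K * s)" by (simp add: algebra_simps)
    qed (use L Gi in \<open>auto intro: integrable_diff\<close>)
    finally show "dist (P a f t) (P b g t) \<le> dist a b + L / K * dist f g" by simp
  qed
  have "\<exists>!f. P a f = f" for a
    using K Pd[of a _ a] by (intro banach_fix_type[of "L / K"]) auto
  then obtain \<phi> where \<phi>: "P a (\<phi> a) = \<phi> a" for a by metis
  define X where "X a t = exp (K * t) *\<^sub>R \<phi> a t" for a t
  have X: "X a t = a + integral {0..t} (\<lambda>s. F (X a s))" if "0 \<le> t" for a t
  proof -
    have "X a t = exp (K * t) *\<^sub>R Q a (\<phi> a) t"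
      unfolding X_def P[symmetric] \<phi> ..
    thus ?thesis
      using that by (simp add: Q_def I_def G_def[abs_def] X_def exp_minus)
  qed
  show ?thesis
  proof
    show "X a 0 = a" for a using X[of 0] by simp
    show "(X a has_vector_derivative F (X a t)) (at t within {0..})" if "0 \<le> t" for a t
    proof -
      have "continuous_on {0..t+1} (\<lambda>s. F (X a s))"
        using Gc[of "{0..t+1}" "\<phi> a"] by (simp add: G_def[abs_def] X_def)
      from integral_has_vector_derivative[OF this, of t] that
      have "((\<lambda>u. a + integral {0..u} (\<lambda>s. F (X a s))) has_vector_derivative F (X a t))
          (at t within {0..t+1})"
        by (auto intro!: derivative_eq_intros)
      hence "(X a has_vector_derivative F (X a t)) (at t within {0..t+1})"
        by (rule has_vector_derivative_transform[rotated -1]) (use X that in auto)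
      also have "at t within {0..t+1} = at t within {0..}"
        by (rule at_within_nhd[of _ "{..<t+1}"]) auto
      finally show ?thesis .
    qed
    show "dist (X a t) (X b t) \<le> (L + 1) * exp ((L + 1) * t) * dist a b" if "0 \<le> t" for a b t
    proof -
      have "dist (\<phi> a) (\<phi> b) \<le> dist a b + L / K * dist (\<phi> a) (\<phi> b)"
        using Pd[of a "\<phi> a" b "\<phi> b"] by (simp add: \<phi>)
      hence "dist (\<phi> a) (\<phi> b) \<le> K * dist a b"
        using K L by (simp add: K_def field_simps)
      hence "dist (\<phi> a t) (\<phi> b t) \<le> K * dist a b"
        using dist_bounded[of "\<phi> a" t "\<phi> b"] by simp
      hence "exp (K * t) * dist (\<phi> a t) (\<phi> b t) \<le> exp (K * t) * (K * dist a b)"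
        by (intro mult_left_mono) auto
      moreover have "dist (X a t) (X b t) = exp (K * t) * dist (\<phi> a t) (\<phi> b t)"
        by (simp add: X_def dist_norm flip: scaleR_diff_right)
      ultimately show ?thesis by (simp add: K_def algebra_simps)
    qed
  qed
qed

text \<open>For negative times the forward flow of \<open>- F\<close> is run backwards and glued on
  at 0, where both pieces have value \<open>a\<close> and one-sided derivative
  \<open>F a\<close>.\<close>

lemma lipschitz_flow:
  fixes F :: "'a::banach \<Rightarrow> 'a"
  assumes F: "L-lipschitz_on UNIV F"
  obtains X :: "'a \<Rightarrow> real \<Rightarrow> 'a" where
    "\<And>a. X a 0 = a"
    "\<And>a t. (X a has_vector_derivative F (X a t)) (at t)"
    "\<And>a b t. 0 \<le> t \<Longrightarrow> dist (X a t) (X b t) \<le> (L + 1) * exp ((L + 1) * t) * dist a b"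
proof -
  obtain X where X: "\<And>a. X a 0 = a"
    "\<And>a t. 0 \<le> t \<Longrightarrow> (X a has_vector_derivative F (X a t)) (at t within {0..})"
    "\<And>a b t. 0 \<le> t \<Longrightarrow> dist (X a t) (X b t) \<le> (L + 1) * exp ((L + 1) * t) * dist a b"
    using lipschitz_forward_flow[OF F] by blast
  have "L-lipschitz_on UNIV (\<lambda>p. - F p)"
    using F by (simp add: lipschitz_on_def dist_minus)
  then obtain Y where Y: "\<And>a. Y a 0 = a"
    "\<And>a t. 0 \<le> t \<Longrightarrow> (Y a has_vector_derivative - F (Y a t)) (at t within {0..})"
    by (rule lipschitz_forward_flow) blast
  define Z where "Z a t = (if t \<in> {0..} then X a t else Y a (- t))" for a and t :: real
  have Y': "((\<lambda>t. Y a (- t)) has_vector_derivative F (Y a (- t))) (at t within {..0})" if "t \<le> 0" for a t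
  proof -
    have img: "uminus ` {..0::real} = {0..}" by (auto simp: image_iff intro: bexI[of _ "- _"])
    have "(uminus has_vector_derivative -1) (at t within {..0})"
      by (auto intro!: derivative_eq_intros)
    moreover have "(Y a has_vector_derivative - F (Y a (- t))) (at (- t) within uminus ` {..0})"
      unfolding img using Y(2) that by simp
    ultimately have "(Y a \<circ> uminus has_vector_derivative (-1) *\<^sub>R (- F (Y a (- t)))) (at t within {..0})"
      by (rule vector_diff_chain_within)
    thus ?thesis by (simp add: o_def)
  qed
  show ?thesis
  proof
    show "Z a 0 = a" for a by (simp add: Z_def X)
    show "(Z a has_vector_derivative F (Z a t)) (at t)" for a t
    proof -
      have "((\<lambda>t. if t \<in> {0..} then X a t else Y a (- t)) has_vector_derivative
         (if t \<in> {0..} then F (X a t) else F (Y a (- t)))) (at t within UNIV)"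
        by (rule has_vector_derivative_If_within_closures[where T = "{..0}"])
          (auto simp: X Y Y' insert_absorb)
      also have "(if t \<in> {0..} then F (X a t) else F (Y a (- t))) = F (Z a t)"
        by (simp add: Z_def)
      finally show ?thesis by (simp add: Z_def[abs_def])
    qed
    show "dist (Z a t) (Z b t) \<le> (L + 1) * exp ((L + 1) * t) * dist a b" if "0 \<le> t" for a b t
      using X(3) that by (simp add: Z_def)
  qed
qed

text \<open>Gronwall in both time directions: the squared distance \<open>E\<close> satisfies
  \<open>\<bar>E' t\<bar> \<le> 2 * L * E t\<close>, so \<open>exp (- 2 * L * t) * E t\<close> is
  nonincreasing and \<open>exp (2 * L * t) * E t\<close> is nondecreasing. Vanishing at
  \<open>t0\<close> therefore spreads forwards and backwards.\<close>

lemma lipschitz_ode_unique: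
  fixes F :: "'a::real_inner \<Rightarrow> 'a"
  assumes F: "L-lipschitz_on UNIV F"
    and X: "\<And>t. (X has_vector_derivative F (X t)) (at t)"
    and Y: "\<And>t. (Y has_vector_derivative F (Y t)) (at t)"
    and eq: "X t0 = Y t0"
  shows "X t = Y t"
proof -
  define D where "D t = X t - Y t" for t
  define E where "E t = D t \<bullet> D t" for t
  define E' where "E' t = 2 * (D t \<bullet> (F (X t) - F (Y t)))" for t
  have "(D has_vector_derivative F (X t) - F (Y t)) (at t)" for t
    unfolding D_def[abs_def] by (intro has_vector_derivative_diff X Y)
  hence "(E has_vector_derivative E' t) (at t)" for t
    unfolding E_def[abs_def] has_vector_derivative_def
    by (auto intro!: derivative_eq_intros simp: E'_def inner_commute algebra_simps)
  hence E: "(E has_real_derivative E' t) (at t)" for t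
    by (simp add: has_real_derivative_iff_has_vector_derivative)
  have E': "\<bar>E' t\<bar> \<le> 2 * L * E t" for t
  proof -
    have "\<bar>D t \<bullet> (F (X t) - F (Y t))\<bar> \<le> norm (D t) * norm (F (X t) - F (Y t))"
      by (rule Cauchy_Schwarz_ineq2)
    also have "norm (F (X t) - F (Y t)) \<le> L * norm (D t)"
      using lipschitz_onD[OF F, of "X t" "Y t"] by (simp add: D_def dist_norm)
    finally have "\<bar>D t \<bullet> (F (X t) - F (Y t))\<bar> \<le> norm (D t) * (L * norm (D t))"
      by (simp add: mult_left_mono)
    also have "\<dots> = L * E t"
      by (simp add: E_def dot_square_norm power2_eq_square)
    finally show ?thesis
      by (simp add: E'_def abs_mult)
  qed
  have t0: "E t0 = 0" by (simp add: E_def D_def eq)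
  have dE: "((\<lambda>t. exp (c * t) * E t) has_real_derivative exp (c * t) * (E' t + c * E t)) (at t)" for c t
    by (rule derivative_eq_intros E refl | simp add: algebra_simps)+
  have "E t \<le> 0"
  proof (cases "t0 \<le> t")
    case True
    have "exp (- 2 * L * t) * E t \<le> exp (- 2 * L * t0) * E t0"
    proof (rule DERIV_nonpos_imp_nonincreasing[OF True])
      show "\<exists>y. ((\<lambda>t. exp (- 2 * L * t) * E t) has_real_derivative y) (at s) \<and> y \<le> 0" for s
        by (rule exI, rule conjI, rule dE) (use E'[of s] in \<open>simp add: mult_le_0_iff\<close>)
    qed
    thus ?thesis by (simp add: t0 mult_le_0_iff)
  next
    case False
    hence "t \<le> t0" by simp
    have "exp (2 * L * t) * E t \<le> exp (2 * L * t0) * E t0"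
    proof (rule DERIV_nonneg_imp_nondecreasing[OF \<open>t \<le> t0\<close>])
      show "\<exists>y. ((\<lambda>t. exp (2 * L * t) * E t) has_real_derivative y) (at s) \<and> 0 \<le> y" for s
        by (rule exI, rule conjI, rule dE) (use E'[of s] in \<open>simp add: zero_le_mult_iff\<close>)
    qed
    thus ?thesis by (simp add: t0 mult_le_0_iff)
  qed
  hence "D t = 0"
    unfolding E_def by (metis inner_eq_zero_iff inner_ge_zero order_antisym)
  thus ?thesis by (simp add: D_def)
qed

subsection \<open>Real functions and their zeros\<close>

text \<open>A zero with negative slope can only be passed downwards, so \<open>d\<close> never rises
  through 0. Starting at \<open>d 0 = 0\<close> is allowed, because the slope there pushes
  \<open>d\<close> below 0 at once.\<close>

lemma negative_if_decreasing_at_zeros: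
  fixes d :: "real \<Rightarrow> real"
  assumes der: "\<And>s. (d has_real_derivative d' s) (at s)"
    and "d 0 \<le> 0"
    and neg: "\<And>s. 0 \<le> s \<Longrightarrow> s \<le> \<tau> \<Longrightarrow> d s = 0 \<Longrightarrow> d' s < 0"
    and t: "0 < t" "t \<le> \<tau>"
  shows "d t < 0"
proof -
  have cont: "continuous_on A d" for A
    by (meson DERIV_continuous der continuous_at_imp_continuous_on)
  have nonpos: "d t \<le> 0" if t: "0 < t" "t \<le> \<tau>" for t
  proof (rule ccontr)
    assume "\<not> d t \<le> 0"
    \<comment> \<open>The last time at which \<open>d\<close> is nonpositive is a zero of
      \<open>d\<close>; the negative slope there yields a later such time.\<close>
    define S where "S = {0..t} \<inter> d -` {..0}"
    have "closed S"
      unfolding S_def by (rule continuous_closed_preimage[OF cont]) auto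
    hence "compact S" by (auto simp: compact_eq_bounded_closed S_def)
    moreover have "0 \<in> S" using assms(2) t by (auto simp: S_def)
    hence "S \<noteq> {}" by auto
    ultimately obtain s where s: "s \<in> S" "\<And>u. u \<in> S \<Longrightarrow> u \<le> s"
      using compact_attains_sup by metis
    have "s < t" using s \<open>\<not> d t \<le> 0\<close> by (auto simp: S_def less_le)
    have "d s = 0"
    proof -
      obtain u where "s \<le> u" "u \<le> t" "d u = 0"
        using IVT'[of d s 0 t] s(1) \<open>s < t\<close> \<open>\<not> d t \<le> 0\<close> cont by (auto simp: S_def)
      hence "u = s" using s by (auto simp: S_def intro: antisym)
      thus ?thesis using \<open>d u = 0\<close> by simp
    qed
    hence "d' s < 0" using neg s t by (auto simp: S_def)
    from DERIV_neg_dec_right[OF der this] obtain e where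
      e: "e > 0" "\<And>h. h > 0 \<Longrightarrow> h < e \<Longrightarrow> d s > d (s + h)" by blast
    define h where "h = min (e / 2) (t - s)"
    have "h > 0" "h < e" "s + h \<le> t" using e \<open>s < t\<close> by (auto simp: h_def)
    hence "s + h \<in> S" using e(2)[of h] \<open>d s = 0\<close> s(1) by (auto simp: S_def)
    thus False using s(2)[of "s + h"] \<open>h > 0\<close> by simp
  qed
  \<comment> \<open>A zero at \<open>t\<close> with negative slope would make \<open>d\<close>
    positive just before \<open>t\<close>.\<close>
  have "d t \<noteq> 0"
  proof
    assume "d t = 0"
    hence "d' t < 0" using neg t by simp
    from DERIV_neg_dec_left[OF der this] obtain e where
      e: "e > 0" "\<And>h. h > 0 \<Longrightarrow> h < e \<Longrightarrow> d t < d (t - h)" by blast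
    define h where "h = min (e / 2) (t / 2)"
    have "h > 0" "h < e" "h < t" using e t by (auto simp: h_def)
    thus False using e(2)[of h] nonpos[of "t - h"] \<open>d t = 0\<close> t by auto
  qed
  thus ?thesis using nonpos t by force
qed

text \<open>Continuous induction: up to the first time with \<open>f \<le> 0\<close> the function is
  nonnegative, so \<open>step\<close> makes it positive at that very time.\<close>

lemma positive_if_bootstrap:
  fixes f :: "real \<Rightarrow> real"
  assumes cont: "\<And>A. continuous_on A f"
    and "0 < f 0"
    and step: "\<And>t. 0 \<le> t \<Longrightarrow> t \<le> \<tau> \<Longrightarrow> (\<And>s. 0 \<le> s \<Longrightarrow> s \<le> t \<Longrightarrow> 0 \<le> f s) \<Longrightarrow> 0 < f t"
    and t: "0 \<le> t" "t \<le> \<tau>"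
  shows "0 < f t"
proof (rule ccontr)
  assume "\<not> 0 < f t"
  define S where "S = {0..t} \<inter> f -` {..0}"
  have "closed S"
    unfolding S_def by (rule continuous_closed_preimage[OF cont]) auto
  hence "compact S" by (auto simp: compact_eq_bounded_closed S_def)
  moreover have "t \<in> S" using \<open>\<not> 0 < f t\<close> t by (auto simp: S_def)
  hence "S \<noteq> {}" by auto
  ultimately obtain s where s: "s \<in> S" "\<And>u. u \<in> S \<Longrightarrow> s \<le> u"
    using compact_attains_inf by metis
  have "0 \<le> f u" if "0 \<le> u" "u \<le> s" for u
  proof (cases "u = s")
    case False
    thus ?thesis using s(2)[of u] s(1) that by (force simp: S_def)
  next
    case True
    obtain v where "0 \<le> v" "v \<le> s" "f v = 0"
      using IVT2'[of f s 0 0] s(1) assms(2) cont by (auto simp: S_def)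
    hence "v = s" using s by (auto simp: S_def intro: antisym)
    thus ?thesis using True \<open>f v = 0\<close> by simp
  qed
  hence "0 < f s" using step[of s] s(1) t by (auto simp: S_def)
  thus False using s(1) by (auto simp: S_def)
qed

lemma sin_less_cos:
  fixes y :: real
  assumes "-2 \<le> y" "y \<le> 0"
  shows "sin y < cos y"
proof -
  have "0 < cos (y + pi / 4)"
    using assms pi_approx by (intro cos_gt_zero_pi) auto
  thus ?thesis by (simp add: cos_add sin_45 cos_45 zero_less_mult_iff flip: right_diff_distrib left_diff_distrib)
qed

lemma sin_minus_ident_lower_bound:
  fixes x :: real
  assumes "0 \<le> x" "x \<le> pi / 2"
  shows "-(3/5) < sin x - x"
proof -
  have "x - sin x \<le> pi / 2 - sin (pi / 2)"
  proof (rule DERIV_nonneg_imp_nondecreasing[OF assms(2)])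
    show "\<exists>D. ((\<lambda>x. x - sin x) has_real_derivative D) (at u) \<and> 0 \<le> D" for u :: real
      by (rule exI[of _ "1 - cos u"]) (auto intro!: derivative_eq_intros)
  qed
  thus ?thesis using pi_approx by simp
qed

lemma continuous_less_near:
  fixes f :: "real \<Rightarrow> real"
  assumes "\<And>A. continuous_on A f" and "f t < c"
  shows "\<exists>e>0. \<forall>s. \<bar>s - t\<bar> < e \<longrightarrow> f s < c"
proof -
  have "isCont f t" using assms(1)[of UNIV] by (simp add: continuous_on_eq_continuous_at)
  hence "\<forall>\<^sub>F s in nhds t. f s < c"
    using assms(2) by (simp add: isCont_def tendsto_at_iff_tendsto_nhds order_tendstoD)
  thus ?thesis by (auto simp: eventually_nhds_metric dist_real_def)
qed

text \<open>The witness \<open>t\<close> survives small changes of \<open>a\<close>: on the compact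
  interval \<open>{0..t}\<close> the strict inequalities hold with a common margin, and both
  functions are Lipschitz in \<open>a\<close> uniformly there. Applied to \<open>x\<close> and
  \<open>y\<close> in both orders, it shows that crossing the top and crossing the side are open
  conditions.\<close>

lemma open_strict_hitting_set:
  fixes u v :: "real \<Rightarrow> real \<Rightarrow> real"
  assumes cont: "\<And>a A. continuous_on A (v a)"
    and u: "\<And>t. \<exists>M. \<forall>a b. \<forall>s\<in>{0..t}. \<bar>u a s - u b s\<bar> \<le> M * \<bar>a - b\<bar>"
    and v: "\<And>t. \<exists>M. \<forall>a b. \<forall>s\<in>{0..t}. \<bar>v a s - v b s\<bar> \<le> M * \<bar>a - b\<bar>"
  shows "open {a. \<exists>t>0. c < u a t \<and> (\<forall>s\<in>{0..t}. v a s < d)}"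
  unfolding open_dist
proof
  fix a assume "a \<in> {a. \<exists>t>0. c < u a t \<and> (\<forall>s\<in>{0..t}. v a s < d)}"
  then obtain t where t: "t > 0" "c < u a t" "\<And>s. s \<in> {0..t} \<Longrightarrow> v a s < d" by auto
  obtain r where r: "r \<in> {0..t}" "\<And>s. s \<in> {0..t} \<Longrightarrow> v a s \<le> v a r"
    using continuous_attains_sup[of "{0..t}" "v a"] cont t by auto
  obtain M N where M: "\<And>a b s. s \<in> {0..t} \<Longrightarrow> \<bar>u a s - u b s\<bar> \<le> M * \<bar>a - b\<bar>"
    and N: "\<And>a b s. s \<in> {0..t} \<Longrightarrow> \<bar>v a s - v b s\<bar> \<le> N * \<bar>a - b\<bar>"
    using u[of t] v[of t] by metis
  define \<epsilon> where "\<epsilon> = min (u a t - c) (d - v a r)"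
  have "\<epsilon> > 0" using t r by (auto simp: \<epsilon>_def)
  define e where "e = \<epsilon> / (\<bar>M\<bar> + \<bar>N\<bar> + 1)"
  have "e > 0" using \<open>\<epsilon> > 0\<close> by (auto simp: e_def)
  have "b \<in> {a. \<exists>t>0. c < u a t \<and> (\<forall>s\<in>{0..t}. v a s < d)}" if "dist b a < e" for b
  proof -
    have "M * \<bar>a - b\<bar> \<le> (\<bar>M\<bar> + \<bar>N\<bar> + 1) * \<bar>a - b\<bar>"
      "N * \<bar>a - b\<bar> \<le> (\<bar>M\<bar> + \<bar>N\<bar> + 1) * \<bar>a - b\<bar>"
      by (intro mult_right_mono; simp)+
    moreover have "(\<bar>M\<bar> + \<bar>N\<bar> + 1) * \<bar>a - b\<bar> < (\<bar>M\<bar> + \<bar>N\<bar> + 1) * e"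
      using that by (intro mult_strict_left_mono) (auto simp: dist_real_def)
    moreover have "(\<bar>M\<bar> + \<bar>N\<bar> + 1) * e = \<epsilon>" by (simp add: e_def)
    ultimately have small: "M * \<bar>a - b\<bar> < \<epsilon>" "N * \<bar>a - b\<bar> < \<epsilon>" by linarith+
    have "c < u b t" using M[of t a b] small t by (auto simp: \<epsilon>_def)
    moreover have "v b s < d" if "s \<in> {0..t}" for s
      using N[of s a b] small r(2)[of s] that by (auto simp: \<epsilon>_def)
    ultimately show ?thesis using t by blast
  qed
  thus "\<exists>e>0. \<forall>b. dist b a < e \<longrightarrow> b \<in> {a. \<exists>t>0. c < u a t \<and> (\<forall>s\<in>{0..t}. v a s < d)}"
    using \<open>e > 0\<close> by blast
qed

subsection \<open>Orbits of the shooting problem\<close>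

locale shifted_abc_orbit =
  fixes x y w :: "real \<Rightarrow> real" and a :: real
  assumes dx: "\<And>t. (x has_real_derivative cos (w t) + cos (y t)) (at t)"
    and dy: "\<And>t. (y has_real_derivative sin (x t) - sin (w t)) (at t)"
    and dw: "\<And>t. (w has_real_derivative sin (y t) + cos (x t)) (at t)"
    and init: "x 0 = 0" "y 0 = a" "w 0 = 0"
    and a: "-(pi / 2) \<le> a" "a \<le> 0"
begin

lemma cont: "continuous_on A x" "continuous_on A y" "continuous_on A w"
  by (meson DERIV_continuous dx dy dw continuous_at_imp_continuous_on)+

text \<open>The bounds \<open>-2 \<le> y\<close> and \<open>-\<pi>/2 \<le> w\<close> imply strictly better ones, and are therefore never
  violated; this is how they disappear in \<open>bounds\<close>.\<close>

lemma bounds_from_crude_bounds: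
  assumes crude: "\<forall>s\<in>{0..\<tau>}. x s \<le> pi / 2 \<and> y s \<le> 0 \<and> -2 \<le> y s \<and> -(pi / 2) \<le> w s"
    and t: "0 \<le> t" "t \<le> \<tau>"
  shows "0 < t \<Longrightarrow> w t < x t" and "a \<le> y t" and "0 \<le> x t" and "-(3/5) < sin (w t)"
proof -
  have x: "x s \<le> pi / 2" and y: "y s \<le> 0" and y2: "-2 \<le> y s" and w: "-(pi / 2) \<le> w s"
    if "0 \<le> s" "s \<le> \<tau>" for s
    using crude that by auto
  \<comment> \<open>Where \<open>w = x\<close> the cosines of \<open>w\<close> and \<open>x\<close>
    cancel, and the derivative of \<open>w - x\<close> is \<open>sin y - cos y < 0\<close>.\<close>
  have wx': "w s < x s" if s: "0 < s" "s \<le> \<tau>" for s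
  proof -
    have "w s - x s < 0"
    proof (rule negative_if_decreasing_at_zeros[OF _ _ _ s])
      show "((\<lambda>s. w s - x s) has_real_derivative
          sin (y s) + cos (x s) - (cos (w s) + cos (y s))) (at s)" for s
        by (intro derivative_intros dx dw)
      show "sin (y s) + cos (x s) - (cos (w s) + cos (y s)) < 0"
        if "0 \<le> s" "s \<le> \<tau>" "w s - x s = 0" for s
        using that sin_less_cos[OF y2 y, of s] by simp
    qed (simp add: init)
    thus ?thesis by simp
  qed
  thus "w t < x t" if "0 < t" using that t by simp
  have wx: "w s \<le> x s" if "0 \<le> s" "s \<le> \<tau>" for s
    using wx'[of s] that init by (cases "s = 0") auto
  have ay: "a \<le> y s" if s: "0 \<le> s" "s \<le> \<tau>" for s
  proof -
    have "y 0 \<le> y s"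
    proof (rule DERIV_nonneg_imp_nondecreasing[OF s(1)])
      show "\<exists>D. (y has_real_derivative D) (at u) \<and> 0 \<le> D" if "0 \<le> u" "u \<le> s" for u
        using dy[of u] sin_monotone_2pi_le[OF w wx x, of u] that s by auto
    qed
    thus ?thesis by (simp add: init)
  qed
  thus "a \<le> y t" using t by simp
  have cosw: "0 \<le> cos (w s)" if s: "0 \<le> s" "s \<le> \<tau>" for s
    using w[OF s] wx[OF s] x[OF s] by (intro cos_ge_zero) auto
  have cosy: "0 \<le> cos (y s)" if s: "0 \<le> s" "s \<le> \<tau>" for s
    using ay[OF s] y[OF s] a by (intro cos_ge_zero) auto
  have "x 0 \<le> x t"
  proof (rule DERIV_nonneg_imp_nondecreasing[OF t(1)])
    show "\<exists>D. (x has_real_derivative D) (at u) \<and> 0 \<le> D" if "0 \<le> u" "u \<le> t" for u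
      by (rule exI, rule conjI, rule dx) (use cosw[of u] cosy[of u] that t in auto)
  qed
  thus x0: "0 \<le> x t" by (simp add: init)
  \<comment> \<open>In the derivative of this combination the products \<open>cos w * cos x\<close>
    cancel, leaving two nonnegative terms. As it starts at 0, \<open>sin w\<close> stays above
    \<open>sin x - x\<close>.\<close>
  have "(\<lambda>s. sin (w s) - sin (x s) + x s) 0 \<le> (\<lambda>s. sin (w s) - sin (x s) + x s) t"
  proof (rule DERIV_nonneg_imp_nondecreasing[OF t(1)])
    fix u assume u: "0 \<le> u" "u \<le> t"
    let ?D = "cos (w u) * (1 + sin (y u)) + (1 - cos (x u)) * cos (y u)"
    have "((\<lambda>s. sin (w s) - sin (x s) + x s) has_real_derivative ?D) (at u)"
      by (auto intro!: derivative_eq_intros dx dw simp: algebra_simps)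
    moreover have "0 \<le> 1 + sin (y u)" using sin_ge_minus_one[of "y u"] by linarith
    hence "0 \<le> cos (w u) * (1 + sin (y u))" "0 \<le> (1 - cos (x u)) * cos (y u)"
      using cosw[of u] cosy[of u] u t by (simp_all add: mult_nonneg_nonneg)
    hence "0 \<le> ?D" by linarith
    ultimately show "\<exists>D. ((\<lambda>s. sin (w s) - sin (x s) + x s) has_real_derivative D) (at u) \<and> 0 \<le> D"
      by blast
  qed
  thus "-(3/5) < sin (w t)"
    using sin_minus_ident_lower_bound[OF x0 x[OF t]] by (simp add: init)
qed

lemma bounds:
  assumes box: "\<forall>s\<in>{0..\<tau>}. x s \<le> pi / 2 \<and> y s \<le> 0"
    and t: "0 \<le> t" "t \<le> \<tau>"
  shows "0 < t \<Longrightarrow> w t < x t" and "a \<le> y t" and "0 \<le> x t" and "-(3/5) < sin (w t)"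
    and "-(pi / 2) < w t" and "w t \<le> pi / 2"
proof -
  \<comment> \<open>The minimum of the two slacks lets both crude bounds be bootstrapped at once.
    The improvements are \<open>-2 < -(pi / 2) \<le> a \<le> y\<close> and
    \<open>sin w > -3/5\<close>, which excludes \<open>w = -(pi / 2)\<close>.\<close>
  have crude: "0 < min (y t + 2) (w t + pi / 2)" if t: "0 \<le> t" "t \<le> \<tau>" for t
  proof (rule positive_if_bootstrap[OF _ _ _ t])
    show "continuous_on A (\<lambda>t. min (y t + 2) (w t + pi / 2))" for A
      by (intro continuous_intros cont)
    show "0 < min (y 0 + 2) (w 0 + pi / 2)"
      using a pi_less_4 by (simp add: init)
    fix t assume t: "0 \<le> t" "t \<le> \<tau>"
      and h: "\<And>s. 0 \<le> s \<Longrightarrow> s \<le> t \<Longrightarrow> 0 \<le> min (y s + 2) (w s + pi / 2)"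
    have crude: "\<forall>s\<in>{0..t}. x s \<le> pi / 2 \<and> y s \<le> 0 \<and> -2 \<le> y s \<and> -(pi / 2) \<le> w s"
    proof
      fix s assume "s \<in> {0..t}"
      thus "x s \<le> pi / 2 \<and> y s \<le> 0 \<and> -2 \<le> y s \<and> -(pi / 2) \<le> w s"
        using h[of s] box t by auto
    qed
    have "a \<le> y t" "-(3/5) < sin (w t)"
      using bounds_from_crude_bounds(2,4)[OF crude t(1) order_refl] .
    moreover have "w t \<noteq> -(pi / 2)" using \<open>-(3/5) < sin (w t)\<close> by auto
    ultimately show "0 < min (y t + 2) (w t + pi / 2)"
      using crude t a pi_less_4 by force
  qed
  have "\<forall>s\<in>{0..\<tau>}. x s \<le> pi / 2 \<and> y s \<le> 0 \<and> -2 \<le> y s \<and> -(pi / 2) \<le> w s"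
  proof
    fix s assume "s \<in> {0..\<tau>}"
    thus "x s \<le> pi / 2 \<and> y s \<le> 0 \<and> -2 \<le> y s \<and> -(pi / 2) \<le> w s"
      using crude[of s] box by auto
  qed
  note b = bounds_from_crude_bounds[OF this t]
  show "0 < t \<Longrightarrow> w t < x t" and "a \<le> y t" "0 \<le> x t" "-(3/5) < sin (w t)"
    by (fact b)+
  show "-(pi / 2) < w t" using crude[OF t] by simp
  show "w t \<le> pi / 2"
  proof (cases "t = 0")
    case False
    moreover have "x t \<le> pi / 2" using box t by simp
    ultimately show ?thesis using b(1) t by simp
  qed (simp add: init)
qed

text \<open>From the lowest starting point the orbit stays to the right of the line
  \<open>y + pi / 2 = x\<close>, so it cannot reach \<open>y = 0\<close> while
  \<open>x \<le> pi / 2\<close>. The bound on \<open>cos w\<close> replaces \<open>cos a\<close>,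
  which is 0 here, as a lower bound for the speed of \<open>x\<close>.\<close>

lemma extreme_bounds:
  assumes box: "\<forall>s\<in>{0..\<tau>}. x s \<le> pi / 2 \<and> y s \<le> 0"
    and "a = -(pi / 2)"
    and t: "0 \<le> t" "t \<le> \<tau>"
  shows "0 < t \<Longrightarrow> y t + pi / 2 < x t" and "4/5 \<le> cos (w t)"
proof -
  note b = bounds[OF box]
  have cosw: "0 \<le> cos (w s)" if s: "0 \<le> s" "s \<le> \<tau>" for s
    using b[OF s] by (intro cos_ge_zero) auto
  have yx': "y s + pi / 2 < x s" if s: "0 < s" "s \<le> \<tau>" for s
  proof -
    have "y s + pi / 2 - x s < 0"
    proof (rule negative_if_decreasing_at_zeros[OF _ _ _ s])
      show "((\<lambda>s. y s + pi / 2 - x s) has_real_derivative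
          sin (x s) - sin (w s) - (cos (w s) + cos (y s))) (at s)" for s
        by (auto intro!: derivative_eq_intros dx dy)
      fix s assume s: "0 \<le> s" "s \<le> \<tau>" "y s + pi / 2 - x s = 0"
      have "cos (y s) = sin (x s)"
      proof -
        have "y s = x s - pi / 2" using s by simp
        thus ?thesis by (simp add: cos_diff)
      qed
      \<comment> \<open>On the line the derivative reduces to \<open>- (sin w + cos w)\<close>. If
        the sum were not positive, \<open>sin w\<close> and \<open>cos w\<close> would both have
        modulus at most 3/5, and their squares would add up to at most 18/25.\<close>
      moreover have "0 < sin (w s) + cos (w s)"
      proof (rule ccontr)
        assume "\<not> 0 < sin (w s) + cos (w s)"
        hence "cos (w s) \<le> 3/5" "\<bar>sin (w s)\<bar> \<le> 3/5"
          using b(4)[OF s(1,2)] cosw[OF s(1,2)] by auto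
        hence "(cos (w s))\<^sup>2 \<le> (3/5)\<^sup>2" "(sin (w s))\<^sup>2 \<le> (3/5)\<^sup>2"
          using cosw[OF s(1,2)] by (auto intro: power_mono simp: abs_le_square_iff[symmetric])
        thus False using sin_cos_squared_add[of "w s"] by (simp add: power2_eq_square)
      qed
      ultimately show "sin (x s) - sin (w s) - (cos (w s) + cos (y s)) < 0" by simp
    qed (simp add: init assms)
    thus ?thesis by simp
  qed
  thus "y t + pi / 2 < x t" if "0 < t" using that t by simp
  \<comment> \<open>Staying to the right of the line gives \<open>sin y \<le> - cos x\<close>, so
    \<open>w\<close> does not increase. Hence \<open>sin w\<close> lies between -3/5 and 0.\<close>
  have "w t \<le> w 0"
  proof (rule DERIV_nonpos_imp_nonincreasing[OF t(1)])
    fix s assume s: "0 \<le> s" "s \<le> t"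
    have "y s \<le> x s - pi / 2"
      using yx'[of s] s t init assms by (cases "s = 0") auto
    moreover have "x s \<le> pi / 2" using box s t by simp
    ultimately have "sin (y s) \<le> sin (x s - pi / 2)"
      using b(2)[of s] s t \<open>a = -(pi / 2)\<close> by (intro sin_monotone_2pi_le) auto
    also have "\<dots> = - cos (x s)" by (simp add: sin_diff)
    finally show "\<exists>D. (w has_real_derivative D) (at s) \<and> D \<le> 0"
      using dw[of s] by (intro exI conjI) auto
  qed
  hence "sin (w t) \<le> 0"
    using b(5)[OF t] init sin_monotone_2pi_le[of "w t" 0] by simp
  hence "(sin (w t))\<^sup>2 \<le> (3/5)\<^sup>2"
    using b(4)[OF t] by (auto simp: abs_le_square_iff[symmetric])
  hence "(4/5)\<^sup>2 \<le> (cos (w t))\<^sup>2"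
    using sin_cos_squared_add[of "w t"] by (simp add: power2_eq_square)
  thus "4/5 \<le> cos (w t)"
    using cosw[OF t] by (rule power2_le_imp_le)
qed

text \<open>The speed \<open>cos w + cos y\<close> of \<open>x\<close> has a positive lower bound
  independent of the duration: \<open>cos a\<close> if \<open>a\<close> is above
  \<open>-(pi / 2)\<close>, and 4/5 from \<open>cos w\<close> otherwise. This forces the orbit out
  of the quadrant in finite time.\<close>

lemma linear_growth:
  assumes "a < 0"
  obtains c where "0 < c" and
    "\<And>\<tau>. 0 \<le> \<tau> \<Longrightarrow> \<forall>s\<in>{0..\<tau>}. x s \<le> pi / 2 \<and> y s \<le> 0 \<Longrightarrow> c * \<tau> \<le> x \<tau>"
proof -
  define c where "c = (if a = -(pi / 2) then 4/5 else cos a)"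
  have "0 < c" using a assms by (auto simp: c_def intro!: cos_gt_zero_pi)
  have "c * \<tau> \<le> x \<tau>"
    if \<tau>: "0 \<le> \<tau>" and h: "\<forall>s\<in>{0..\<tau>}. x s \<le> pi / 2 \<and> y s \<le> 0" for \<tau>
  proof -
    have "(\<lambda>s. x s - c * s) 0 \<le> (\<lambda>s. x s - c * s) \<tau>"
    proof (rule DERIV_nonneg_imp_nondecreasing[OF \<tau>])
      fix s assume s: "0 \<le> s" "s \<le> \<tau>"
      note b = bounds[OF h s]
      have cosw: "0 \<le> cos (w s)"
        using b by (intro cos_ge_zero) auto
      have ay: "a \<le> y s" "y s \<le> 0" using b h s by auto
      have cosy: "0 \<le> cos (y s)"
        using ay a by (intro cos_ge_zero) auto
      have "c \<le> cos (w s) + cos (y s)"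
      proof (cases "a = -(pi / 2)")
        case True
        have "4/5 \<le> cos (w s)" using extreme_bounds(2)[OF h True s] .
        thus ?thesis using cosy True by (simp add: c_def)
      next
        case False
        have "cos a \<le> cos (y s)"
          using ay a by (intro cos_monotone_minus_pi_0') auto
        thus ?thesis using cosw False by (simp add: c_def)
      qed
      moreover have "((\<lambda>s. x s - c * s) has_real_derivative cos (w s) + cos (y s) - c) (at s)"
        by (auto intro!: derivative_eq_intros dx)
      ultimately show "\<exists>D. ((\<lambda>s. x s - c * s) has_real_derivative D) (at s) \<and> 0 \<le> D"
        by (intro exI conjI) auto
    qed
    thus ?thesis by (simp add: init)
  qed
  thus ?thesis using \<open>0 < c\<close> that by blast
qed

section \<open>Exit through the top, the side or the corner\<close>

text \<open>All inequalities in the two crossing conditions are strict, and the exit line is passed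
  rather than just touched; this is what makes them open in \<open>a\<close>.\<close>

definition "crosses_top \<longleftrightarrow> (\<exists>t>0. 0 < y t \<and> (\<forall>s\<in>{0..t}. x s < pi / 2))"
definition "crosses_side \<longleftrightarrow> (\<exists>t>0. pi / 2 < x t \<and> (\<forall>s\<in>{0..t}. y s < 0))"
definition "hits_corner \<longleftrightarrow> (\<exists>t>0. x t = pi / 2 \<and> y t = 0)"

lemma first_exit:
  assumes "a < 0"
  obtains \<tau> where "0 < \<tau>"
    and "\<And>s. 0 \<le> s \<Longrightarrow> s < \<tau> \<Longrightarrow> x s < pi / 2 \<and> y s < 0"
    and "x \<tau> \<le> pi / 2" "y \<tau> \<le> 0" "x \<tau> = pi / 2 \<or> y \<tau> = 0"
proof -
  obtain c where c: "0 < c"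
    "\<And>\<tau>. 0 \<le> \<tau> \<Longrightarrow> \<forall>s\<in>{0..\<tau>}. x s \<le> pi / 2 \<and> y s \<le> 0 \<Longrightarrow> c * \<tau> \<le> x \<tau>"
    using linear_growth[OF assms] by blast
  \<comment> \<open>By this time the linear growth would have carried \<open>x\<close> to
    \<open>pi\<close>, beyond the side \<open>pi / 2\<close>.\<close>
  define M where "M = pi / c"
  have "M \<ge> 0" using c by (simp add: M_def)
  have "\<exists>s\<in>{0..M}. pi / 2 \<le> x s \<or> 0 \<le> y s"
  proof (rule ccontr)
    assume "\<not> ?thesis"
    hence h: "\<forall>s\<in>{0..M}. x s < pi / 2 \<and> y s < 0"
      by (simp add: not_le)
    hence "c * M \<le> x M" using c(2)[OF \<open>M \<ge> 0\<close>] by (simp add: less_imp_le)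
    moreover have "c * M = pi" using c by (simp add: M_def)
    moreover have "x M < pi / 2" using h \<open>M \<ge> 0\<close> by simp
    ultimately show False using pi_gt_zero by linarith
  qed
  moreover define S where "S = {0..M} \<inter> (x -` {pi / 2..} \<union> y -` {0..})"
  ultimately have "S \<noteq> {}" by auto
  have "closed S"
    unfolding S_def Int_Un_distrib
    by (intro closed_Un continuous_closed_preimage cont) auto
  hence "compact S" by (auto simp: compact_eq_bounded_closed S_def)
  then obtain \<tau> where \<tau>: "\<tau> \<in> S" "\<And>s. s \<in> S \<Longrightarrow> \<tau> \<le> s"
    using compact_attains_inf \<open>S \<noteq> {}\<close> by metis
  have before: "x s < pi / 2 \<and> y s < 0" if "0 \<le> s" "s < \<tau>" for s
    using \<tau>(2)[of s] \<tau>(1) that by (fastforce simp: S_def)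
  have "\<tau> \<ge> 0" "\<tau> \<noteq> 0" using \<tau>(1) init assms
    by (auto simp: S_def dest: order.strict_trans2[OF pi_gt_zero])
  hence "0 < \<tau>" by simp
  have "x \<tau> \<le> pi / 2"
  proof (rule ccontr)
    assume "\<not> x \<tau> \<le> pi / 2"
    then obtain s where "0 \<le> s" "s \<le> \<tau>" "x s = pi / 2"
      using IVT'[of x 0 "pi / 2" \<tau>] init \<open>0 < \<tau>\<close> cont by auto
    thus False using before[of s] \<open>\<not> x \<tau> \<le> pi / 2\<close> by (cases "s = \<tau>") auto
  qed
  moreover have "y \<tau> \<le> 0"
  proof (rule ccontr)
    assume "\<not> y \<tau> \<le> 0"
    then obtain s where "0 \<le> s" "s \<le> \<tau>" "y s = 0"
      using IVT'[of y 0 0 \<tau>] init assms \<open>0 < \<tau>\<close> cont by auto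
    thus False using before[of s] \<open>\<not> y \<tau> \<le> 0\<close> by (cases "s = \<tau>") auto
  qed
  moreover have "x \<tau> = pi / 2 \<or> y \<tau> = 0"
    using \<tau>(1) calculation by (auto simp: S_def)
  ultimately show ?thesis using that[OF \<open>0 < \<tau>\<close> before] by simp
qed

text \<open>The exit is transversal: at the side \<open>x' = cos w + cos y > 0\<close>, and at the
  top \<open>y' = sin x - sin w > 0\<close> because \<open>w < x < pi / 2\<close>. So touching one
  line away from the corner means passing it, while the other coordinate keeps its strict inequality
  for a short while.\<close>

lemma alternatives:
  assumes "a < 0"
  shows "hits_corner \<or> crosses_side \<or> a \<noteq> -(pi / 2) \<and> crosses_top"
proof -
  obtain \<tau> where \<tau>: "0 < \<tau>"
    and before: "\<And>s. 0 \<le> s \<Longrightarrow> s < \<tau> \<Longrightarrow> x s < pi / 2 \<and> y s < 0"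
    and exit: "x \<tau> \<le> pi / 2" "y \<tau> \<le> 0" "x \<tau> = pi / 2 \<or> y \<tau> = 0"
    using first_exit[OF assms] by blast
  have box: "\<forall>s\<in>{0..\<tau>}. x s \<le> pi / 2 \<and> y s \<le> 0"
    using before exit by (auto simp: le_less)
  note b = bounds[OF box less_imp_le[OF \<tau>] order_refl]
  consider "x \<tau> = pi / 2" "y \<tau> = 0" | "x \<tau> = pi / 2" "y \<tau> < 0" | "x \<tau> < pi / 2" "y \<tau> = 0"
    using exit by fastforce
  thus ?thesis
  proof cases
    case 1
    thus ?thesis using \<tau> by (auto simp: hits_corner_def)
  next
    case 2
    have "0 < cos (w \<tau>)" using b \<tau> 2 by (intro cos_gt_zero_pi) auto
    moreover have "0 \<le> cos (y \<tau>)" using b(2) \<tau> 2 a by (intro cos_ge_zero) auto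
    ultimately have "0 < cos (w \<tau>) + cos (y \<tau>)" by simp
    from DERIV_pos_inc_right[OF dx this] obtain d where
      d: "d > 0" "\<And>h. h > 0 \<Longrightarrow> h < d \<Longrightarrow> x \<tau> < x (\<tau> + h)" by blast
    obtain e where e: "e > 0" "\<And>s. \<bar>s - \<tau>\<bar> < e \<Longrightarrow> y s < 0"
      using continuous_less_near[OF cont(2) 2(2)] by blast
    define h where "h = min d e / 2"
    have "h > 0" "h < d" "h < e" using d e by (auto simp: h_def)
    have "y s < 0" if "s \<in> {0..\<tau> + h}" for s
      using before[of s] e(2)[of s] that \<open>h < e\<close> \<open>h > 0\<close> by (cases "s < \<tau>") auto
    hence crosses_side
      unfolding crosses_side_def using d(2)[of h] 2 \<tau> \<open>h > 0\<close> \<open>h < d\<close>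
      by (intro exI[of _ "\<tau> + h"]) auto
    thus ?thesis by simp
  next
    case 3
    have "a \<noteq> -(pi / 2)"
      using extreme_bounds(1)[OF box _ less_imp_le[OF \<tau>] order_refl] 3 \<tau> by auto
    have "sin (w \<tau>) < sin (x \<tau>)"
      using b \<tau> 3 by (intro sin_monotone_2pi) auto
    hence "0 < sin (x \<tau>) - sin (w \<tau>)" by simp
    from DERIV_pos_inc_right[OF dy this] obtain d where
      d: "d > 0" "\<And>h. h > 0 \<Longrightarrow> h < d \<Longrightarrow> y \<tau> < y (\<tau> + h)" by blast
    obtain e where e: "e > 0" "\<And>s. \<bar>s - \<tau>\<bar> < e \<Longrightarrow> x s < pi / 2"
      using continuous_less_near[OF cont(1) 3(1)] by blast
    define h where "h = min d e / 2"
    have "h > 0" "h < d" "h < e" using d e by (auto simp: h_def)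
    have "x s < pi / 2" if "s \<in> {0..\<tau> + h}" for s
      using before[of s] e(2)[of s] that \<open>h < e\<close> \<open>h > 0\<close> by (cases "s < \<tau>") auto
    hence crosses_top
      unfolding crosses_top_def using d(2)[of h] 3 \<tau> \<open>h > 0\<close> \<open>h < d\<close>
      by (intro exI[of _ "\<tau> + h"]) auto
    thus ?thesis using \<open>a \<noteq> -(pi / 2)\<close> by simp
  qed
qed

text \<open>The orbit starts on the top line with \<open>y' = 0\<close>, so the second derivative
  decides; at time 0 it equals 2 - 1 = 1.\<close>

lemma crosses_top_if_zero:
  assumes "a = 0"
  shows crosses_top
proof -
  have "((\<lambda>t. sin (x t) - sin (w t)) has_real_derivative 1) (at 0)"
    by (auto intro!: derivative_eq_intros dx dw simp: init assms)
  from DERIV_pos_inc_right[OF this] obtain d where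
    d: "d > 0" "\<And>h. h > 0 \<Longrightarrow> h < d \<Longrightarrow> 0 < sin (x h) - sin (w h)"
    by (auto simp: init)
  obtain e where e: "e > 0" "\<And>s. \<bar>s - 0\<bar> < e \<Longrightarrow> x s < pi / 2"
    using continuous_less_near[OF cont(1), of 0 "pi / 2"] init by auto
  define h where "h = min d e / 2"
  have h: "h > 0" "h < d" "h < e" using d e by (auto simp: h_def)
  have "y 0 < y h"
  proof (rule DERIV_pos_imp_increasing_open[OF h(1)])
    show "\<exists>D. (y has_real_derivative D) (at s) \<and> 0 < D" if "0 < s" "s < h" for s
      by (rule exI, rule conjI, rule dy) (use d(2)[of s] that h in auto)
  qed (rule cont)
  thus ?thesis
    unfolding crosses_top_def using h e init assms by (intro exI[of _ h]) auto
qed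

text \<open>Whichever crossing time comes first violates the condition that the other crossing
  imposes up to its own time.\<close>

lemma not_crosses_both: "\<not> (crosses_top \<and> crosses_side)"
  unfolding crosses_top_def crosses_side_def
  by (smt (verit, best) atLeastAtMost_iff)

end

subsection \<open>The ballistic orbit\<close>

lemma vector_3_eq_axis_sum:
  "(vector [x, y, z] :: real ^ 3) = x *\<^sub>R axis 1 1 + y *\<^sub>R axis 2 1 + z *\<^sub>R axis 3 1"
  by (simp add: vec_eq_iff forall_3 axis_def)

lemma has_vector_derivative_vector_3:
  fixes x y z :: "real \<Rightarrow> real"
  shows "((\<lambda>t. vector [x t, y t, z t] :: real ^ 3) has_vector_derivative vector [x', y', z']) (at t) \<longleftrightarrow>
    (x has_real_derivative x') (at t) \<and> (y has_real_derivative y') (at t) \<and>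
    (z has_real_derivative z') (at t)" (is "(?X has_vector_derivative ?X') _ \<longleftrightarrow> _")
proof (intro iffI)
  assume X: "(?X has_vector_derivative ?X') (at t)"
  have "((\<lambda>t. ?X t $ i) has_vector_derivative ?X' $ i) (at t)" for i
    by (rule bounded_linear.has_vector_derivative[OF bounded_linear_vec_nth X])
  from this[of 1] this[of 2] this[of 3]
  show "(x has_real_derivative x') (at t) \<and> (y has_real_derivative y') (at t) \<and>
      (z has_real_derivative z') (at t)"
    by (simp add: has_real_derivative_iff_has_vector_derivative)
next
  assume "(x has_real_derivative x') (at t) \<and> (y has_real_derivative y') (at t) \<and>
      (z has_real_derivative z') (at t)"
  thus "(?X has_vector_derivative ?X') (at t)"
    unfolding vector_3_eq_axis_sum has_real_derivative_iff_has_vector_derivative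
    by (intro has_vector_derivative_add
        bounded_linear.has_vector_derivative[OF bounded_linear_scaleR_left]) auto
qed

lemma abc_solution_vector_iff:
  "abc_solution (\<lambda>t. vector [x t, y t, z t]) \<longleftrightarrow>
    (\<forall>t. (x has_real_derivative sin (z t) + cos (y t)) (at t) \<and>
         (y has_real_derivative sin (x t) + cos (z t)) (at t) \<and>
         (z has_real_derivative sin (y t) + cos (x t)) (at t))"
  by (simp add: abc_solution_def abc_field_def has_vector_derivative_vector_3)

lemma vector_3_eta: "vector [p $ 1, p $ 2, p $ 3] = (p :: 'a::zero ^ 3)"
  by (simp add: vec_eq_iff forall_3)

text \<open>Sine and cosine are 1-Lipschitz, so each of the three components is 2-Lipschitz, and the
  norm is at most the sum of the components' moduli.\<close>

lemma abc_field_lipschitz: "6-lipschitz_on UNIV abc_field"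
proof (rule lipschitz_onI)
  fix p q :: "real ^ 3"
  have sin: "\<bar>sin u - sin v\<bar> \<le> \<bar>u - v\<bar>" for u v :: real
  proof -
    have "\<bar>sin u - sin v\<bar> = 2 * \<bar>sin ((u - v) / 2)\<bar> * \<bar>cos ((u + v) / 2)\<bar>"
      by (simp add: sin_diff_sin abs_mult)
    also have "\<dots> \<le> 2 * \<bar>sin ((u - v) / 2)\<bar> * 1"
      by (intro mult_left_mono) auto
    also have "\<dots> \<le> \<bar>u - v\<bar>"
      using abs_sin_x_le_abs_x[of "(u - v) / 2"] by simp
    finally show ?thesis .
  qed
  have cos: "\<bar>cos u - cos v\<bar> \<le> \<bar>u - v\<bar>" for u v :: real
    using sin[of "pi / 2 - u" "pi / 2 - v"] by (simp add: sin_diff)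
  have comp: "\<bar>p $ i - q $ i\<bar> \<le> dist p q" for i
    using component_le_norm_cart[of "p - q" i] by (simp add: dist_norm)
  have sum: "\<bar>(sin u + cos v) - (sin u' + cos v')\<bar> \<le> \<bar>u - u'\<bar> + \<bar>v - v'\<bar>" for u v u' v' :: real
    using sin[of u u'] cos[of v v'] by linarith
  have "\<bar>(abc_field p - abc_field q) $ i\<bar> \<le> 2 * dist p q" for i
  proof -
    have "\<forall>i. \<bar>(abc_field p - abc_field q) $ i\<bar> \<le> 2 * dist p q"
      unfolding forall_3 vector_minus_component abc_field_def vector_3
      using order_trans[OF sum add_mono[OF comp comp]] by simp
    thus ?thesis ..
  qed
  hence "(\<Sum>i\<in>UNIV. \<bar>(abc_field p - abc_field q) $ i\<bar>) \<le> (\<Sum>i::3\<in>UNIV. 2 * dist p q)"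
    by (intro sum_mono)
  moreover have "dist (abc_field p) (abc_field q) \<le> (\<Sum>i\<in>UNIV. \<bar>(abc_field p - abc_field q) $ i\<bar>)"
    unfolding dist_norm by (rule norm_le_l1_cart)
  ultimately show "dist (abc_field p) (abc_field q) \<le> 6 * dist p q" by simp
qed simp

lemma abc_solution_unique:
  assumes "abc_solution X" "abc_solution Y" "X t0 = Y t0"
  shows "X = Y"
proof
  show "X t = Y t" for t
    using lipschitz_ode_unique[OF abc_field_lipschitz, of X Y t0] assms
    by (simp add: abc_solution_def)
qed

text \<open>The conditions at times 0 and \<open>T\<close> say that the orbit joins the two lines
  fixed by the reversing symmetries.\<close>

lemma abc_connecting_orbit:
  obtains x y z T where "abc_solution (\<lambda>t. vector [x t, y t, z t])" and "0 < T"
    and "x 0 = 0" "z 0 = pi / 2" and "x T = pi / 2" "y T = 0"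
proof -
  obtain \<Phi> where \<Phi>: "\<And>p. \<Phi> p 0 = p"
    "\<And>p t. (\<Phi> p has_vector_derivative abc_field (\<Phi> p t)) (at t)"
    "\<And>p q t. 0 \<le> t \<Longrightarrow> dist (\<Phi> p t) (\<Phi> q t) \<le> (6 + 1) * exp ((6 + 1) * t) * dist p q"
    using lipschitz_flow[OF abc_field_lipschitz] by blast
  define X where "X a = \<Phi> (vector [0, a, pi / 2])" for a
  define x y z where "x a t = X a t $ 1" and "y a t = X a t $ 2" and "z a t = X a t $ 3" for a t
  have Xxyz: "(\<lambda>t. vector [x a t, y a t, z a t]) = X a" for a
    by (simp add: x_def y_def z_def vector_3_eta)
  have sol: "abc_solution (\<lambda>t. vector [x a t, y a t, z a t])" for a
    unfolding Xxyz by (simp add: abc_solution_def X_def \<Phi>)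
  note der = sol[unfolded abc_solution_vector_iff, rule_format]
  have init: "x a 0 = 0" "y a 0 = a" "z a 0 = pi / 2" for a
    by (simp_all add: x_def y_def z_def X_def \<Phi>)
  have orbit: "shifted_abc_orbit (x a) (y a) (\<lambda>t. z a t - pi / 2) a" if "a \<in> {-(pi / 2)..0}" for a
  proof
    show "(x a has_real_derivative cos (z a t - pi / 2) + cos (y a t)) (at t)"
      "(y a has_real_derivative sin (x a t) - sin (z a t - pi / 2)) (at t)" for t
      using der[of a t] by (simp_all add: sin_diff cos_diff)
    show "((\<lambda>t. z a t - pi / 2) has_real_derivative sin (y a t) + cos (x a t)) (at t)" for t
      using der[of a t] by (auto intro!: derivative_eq_intros)
  qed (use that in \<open>auto simp: init\<close>)
  have cont: "continuous_on A (x a)" "continuous_on A (y a)" for A a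
    by (meson DERIV_continuous der continuous_at_imp_continuous_on)+
  have comp_lip: "\<bar>X a s $ i - X b s $ i\<bar> \<le> 7 * exp (7 * t) * \<bar>a - b\<bar>" if "s \<in> {0..t}" for a b s t i
  proof -
    have "\<bar>X a s $ i - X b s $ i\<bar> \<le> dist (X a s) (X b s)"
      using component_le_norm_cart[of "X a s - X b s" i] by (simp add: dist_norm)
    also have "\<dots> \<le> 7 * exp (7 * s) * dist (vector [0, a, pi / 2] :: real ^ 3) (vector [0, b, pi / 2])"
      using \<Phi>(3)[of s] that by (simp add: X_def)
    also have "dist (vector [0, a, pi / 2] :: real ^ 3) (vector [0, b, pi / 2]) = \<bar>a - b\<bar>"
      by (simp add: dist_vec_def L2_set_def sum_3 dist_real_def)
    also have "7 * exp (7 * s) * \<bar>a - b\<bar> \<le> 7 * exp (7 * t) * \<bar>a - b\<bar>"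
      using that by (intro mult_right_mono) auto
    finally show ?thesis .
  qed
  have lip: "\<exists>M. \<forall>a b. \<forall>s\<in>{0..t}. \<bar>x a s - x b s\<bar> \<le> M * \<bar>a - b\<bar>"
    "\<exists>M. \<forall>a b. \<forall>s\<in>{0..t}. \<bar>y a s - y b s\<bar> \<le> M * \<bar>a - b\<bar>" for t
    unfolding x_def y_def using comp_lip by blast+
  \<comment> \<open>The crossing conditions are restated for every real \<open>a\<close>, so that
    they define open subsets of the line; inside the parameter interval they agree with the locale
    predicates.\<close>
  define U where "U = {a. \<exists>t>0. 0 < y a t \<and> (\<forall>s\<in>{0..t}. x a s < pi / 2)}"
  define V where "V = {a. \<exists>t>0. pi / 2 < x a t \<and> (\<forall>s\<in>{0..t}. y a s < 0)}"
  have "open U"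
    unfolding U_def using lip by (intro open_strict_hitting_set cont)
  have "open V"
    unfolding V_def using lip by (intro open_strict_hitting_set cont)
  have U: "a \<in> U \<longleftrightarrow> shifted_abc_orbit.crosses_top (x a) (y a)"
    and V: "a \<in> V \<longleftrightarrow> shifted_abc_orbit.crosses_side (x a) (y a)"
    if "a \<in> {-(pi / 2)..0}" for a
    using orbit[OF that]
    by (auto simp: U_def V_def shifted_abc_orbit.crosses_top_def shifted_abc_orbit.crosses_side_def)
  have "\<exists>a\<in>{-(pi / 2)..0}. shifted_abc_orbit.hits_corner (x a) (y a)"
  proof (rule ccontr)
    assume no: "\<not> ?thesis"
    \<comment> \<open>Without a corner hit, \<open>U\<close> and \<open>V\<close> would be disjoint
      on the interval and cover it, with 0 in \<open>U\<close> and \<open>-(pi / 2)\<close> in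
      \<open>V\<close>, against connectedness.\<close>
    have "U \<inter> V \<inter> {-(pi / 2)..0} = {}"
      using U V shifted_abc_orbit.not_crosses_both[OF orbit] by blast
    moreover have alt: "a \<in> V \<or> a \<noteq> -(pi / 2) \<and> a \<in> U" if "a \<in> {-(pi / 2)..<0}" for a
      using shifted_abc_orbit.alternatives[OF orbit[of a]] no U[of a] V[of a] that by auto
    moreover have "0 \<in> U"
      using U[of 0] shifted_abc_orbit.crosses_top_if_zero[OF orbit[of 0]] by simp
    moreover have "{-(pi / 2)..0} \<subseteq> U \<union> V"
    proof
      fix a assume "a \<in> {-(pi / 2)..0}"
      thus "a \<in> U \<union> V" using alt[of a] \<open>0 \<in> U\<close> by (cases "a = 0") auto
    qed
    ultimately have "V \<inter> {-(pi / 2)..0} = {}"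
      using connectedD[OF connected_Icc \<open>open U\<close> \<open>open V\<close>, of "-(pi / 2)" 0] by auto
    thus False using alt[of "-(pi / 2)"] by auto
  qed
  then obtain a where a: "a \<in> {-(pi / 2)..0}" and "shifted_abc_orbit.hits_corner (x a) (y a)"
    by blast
  then obtain T where T: "T > 0" "x a T = pi / 2" "y a T = 0"
    using shifted_abc_orbit.hits_corner_def[OF orbit[OF a]] by blast
  show ?thesis by (rule that[OF sol T(1) init(1,3) T(2,3)])
qed

theorem theorem1p1:
  shows "\<exists>t0 > 0. \<exists>x y z :: real \<Rightarrow> real.
    (let X = (\<lambda>t. vector [x t, y t, z t]);
         Y = (\<lambda>t. vector [z t, x t, y t]);
         Z = (\<lambda>t. vector [y t, z t, x t])
     in abc_solution X \<and> (\<forall>t. X (t + t0) = X t + vector [2 * pi, 0, 0]) \<and>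
        abc_solution Y \<and> (\<forall>t. Y (t + t0) = Y t + vector [0, 2 * pi, 0]) \<and>
        abc_solution Z \<and> (\<forall>t. Z (t + t0) = Z t + vector [0, 0, 2 * pi]))"
proof -
  obtain x y z T where sol: "abc_solution (\<lambda>t. vector [x t, y t, z t])" and T: "0 < T"
    and start: "x 0 = 0" "z 0 = pi / 2" and stop: "x T = pi / 2" "y T = 0"
    by (rule abc_connecting_orbit)
  note der = sol[unfolded abc_solution_vector_iff, rule_format]
  have reflect: "((\<lambda>t. f (c - t)) has_real_derivative - D) (at t)"
    if "(f has_real_derivative D) (at (c - t))" for f :: "real \<Rightarrow> real" and c t D
  proof -
    have "((\<lambda>t. c - t) has_real_derivative - 1) (at t)"
      by (auto intro!: derivative_eq_intros)
    from DERIV_chain2[OF that this] show ?thesis by simp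
  qed
  note d = reflect[OF der[THEN conjunct1]] reflect[OF der[THEN conjunct2, THEN conjunct1]]
    reflect[OF der[THEN conjunct2, THEN conjunct2]]
  \<comment> \<open>First reversing symmetry. With \<open>c = 0\<close> the reflected solution meets
    the original at time 0, on the fixed line, so uniqueness identifies them.\<close>
  have "abc_solution (\<lambda>t. vector [- x (c - t), y (c - t), pi - z (c - t)])" for c
    unfolding abc_solution_vector_iff
    by (intro allI conjI; rule DERIV_cong, (rule DERIV_minus DERIV_diff DERIV_const d)+, simp)
  from abc_solution_unique[OF sol this[of 0], of 0] start
  have eq_0: "vector [x t, y t, z t] = (vector [- x (0 - t), y (0 - t), pi - z (0 - t)] :: real ^ 3)" for t
    by (simp add: fun_eq_iff)
  have at_0: "x t = - x (- t)" "y t = y (- t)" "z t = pi - z (- t)" for t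
    using eq_0[of t] by (simp_all add: vec_eq_iff forall_3)
  \<comment> \<open>Second reversing symmetry. The choice \<open>c = 2 * T\<close> makes
    \<open>T\<close> the fixed time of \<open>c - t\<close>, when the orbit is on the other
    line.\<close>
  have "abc_solution (\<lambda>t. vector [pi - x (c - t), - y (c - t), z (c - t)])" for c
    unfolding abc_solution_vector_iff
    by (intro allI conjI; rule DERIV_cong, (rule DERIV_minus DERIV_diff DERIV_const d)+, simp)
  from abc_solution_unique[OF sol this[of "2 * T"], of T] stop
  have eq_T: "vector [x t, y t, z t] = (vector [pi - x (2 * T - t), - y (2 * T - t), z (2 * T - t)] :: real ^ 3)" for t
    by (simp add: fun_eq_iff)
  have at_T: "x t = pi - x (2 * T - t)" "y t = - y (2 * T - t)" "z t = z (2 * T - t)" for t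
    using eq_T[of t] by (simp_all add: vec_eq_iff forall_3)
  \<comment> \<open>Composing the two reflections of time gives a shift by \<open>2 * T\<close>. It
    still flips \<open>y\<close> and \<open>z\<close>, and only its second iterate is a pure
    translation, hence the period \<open>4 * T\<close>.\<close>
  have half: "x (t + 2 * T) = x t + pi" "y (t + 2 * T) = - y t" "z (t + 2 * T) = pi - z t" for t
    using at_0[of t] at_T[of "t + 2 * T"] by simp_all
  have period: "x (t + 4 * T) = x t + 2 * pi" "y (t + 4 * T) = y t" "z (t + 4 * T) = z t" for t
  proof -
    have "t + 4 * T = t + 2 * T + 2 * T" by simp
    thus "x (t + 4 * T) = x t + 2 * pi" "y (t + 4 * T) = y t" "z (t + 4 * T) = z t"
      by (simp_all only: half)
  qed
  \<comment> \<open>The system is invariant under cyclic permutation of the coordinates.\<close>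
  have rotated: "abc_solution (\<lambda>t. vector [z t, x t, y t])"
    "abc_solution (\<lambda>t. vector [y t, z t, x t])"
    using sol unfolding abc_solution_vector_iff by (simp_all add: add.commute)
  show ?thesis
    unfolding Let_def
    by (rule exI[of _ "4 * T"], rule conjI, use T in simp,
        rule exI[of _ x], rule exI[of _ y], rule exI[of _ z])
      (simp add: sol rotated period vec_eq_iff forall_3)
qed

end
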